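(* Let $n\ge 1$ and let $f:\mathbb R^n\to\mathbb R$ satisfy the standing assumptions (A1)–(A3) stated in the context. For each $t>0$ let $x_t\in\operatorname*{arg\,min}_{x\in\mathbb R^n}P_tf$ be a global minimizer of $P_tf$. Then $\|x_t\|_2=O(\sqrt t)$ as $t\to0^+$; that is, there exist constants $M>0$ and $t_0>0$ such that $\|x_t\|_2\le M\sqrt t$ for all $0<t<t_0$.
   Context: Notation: $\|\cdot\|_2$ is the Euclidean norm on $\mathbb R^n$ and $B_\rho(0)=\{x:\|x\|_2<\rho\}$. For $t>0$ the heat kernel is $G_t(y)=\frac{1}{(4\pi t)^{n/2}}e^{-\|y\|_2^2/(4t)}$, and the heat-kernel regularization of $f$ is $(P_tf)(x)=\int_{\mathbb R^n}G_t(x-y)f(y)\,dy$. For $a\in[1,2]$, $\Phi_a(x)=\sum_{i=1}^n|x_i|^a$. Standing assumptions on the (Lebesgue measurable) function $f:\mathbb R^n\to\mathbb R$: (A1) Global quadratic lower bound: there is a constant $c>0$ with $f(x)\ge c\|x\|_2^2$ for all $x\in\mathbb R^n$. The distinguished minimizer is at the origin, with $f(0)=0$. (A2) Local leading-order profile: there exist $a\in[1,2]$, $r_0>0$, a function $r:\mathbb R^n\to\mathbb R$ and a function $\omega:[0,r_0)\to[0,\infty)$ with $\lim_{\rho\to0^+}\omega(\rho)=0$ such that $f(x)=\Phi_a(x)+r(x)$ and $|r(x)|\le\omega(\|x\|_2)\,\Phi_a(x)$ for all $x\in B_{r_0}(0)$. (A3) Polynomial tail control: there exist constants $C>0$ and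 $m\ge2$ such that $f(x)\le C(1+\|x\|_2^m)$ for all $x\in\mathbb R^n$. *)

theory Defs
  imports "HOL-Analysis.Analysis"
begin

definition heat_kernel :: "real \<Rightarrow> real ^ 'n \<Rightarrow> real" where
  "heat_kernel t y =
     1 / (4 * pi * t) powr (real CARD('n) / 2) * exp (- (norm y)\<^sup>2 / (4 * t))"

text \<open>The integral is taken over \<^const>\<open>lebesgue\<close> rather than \<^const>\<open>lborel\<close> because
  the functions considered are only assumed to be Lebesgue measurable.\<close>

definition heat_regularization :: "real \<Rightarrow> (real ^ 'n \<Rightarrow> real) \<Rightarrow> real ^ 'n \<Rightarrow> real" where
  "heat_regularization t f x = (LINT y|lebesgue. heat_kernel t (x - y) * f y)"

definition Phi :: "real \<Rightarrow> real ^ 'n \<Rightarrow> real" where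
  "Phi a x = (\<Sum>i\<in>UNIV. \<bar>x $ i\<bar> powr a)"

definition quadratic_lower_bound :: "(real ^ 'n \<Rightarrow> real) \<Rightarrow> bool" where
  "quadratic_lower_bound f \<longleftrightarrow>
     (\<exists>c>0. \<forall>x. f x \<ge> c * (norm x)\<^sup>2) \<and> f 0 = 0"

text \<open>The modulus \<open>\<omega>\<close>, a function from $[0,r_0)$ to $[0,\infty)$, is a total function
  constrained only on \<open>{0..<r0}\<close>; likewise \<open>r\<close> is constrained only on \<open>ball 0 r0\<close>.\<close>

definition local_profile :: "(real ^ 'n \<Rightarrow> real) \<Rightarrow> bool" where
  "local_profile f \<longleftrightarrow>
     (\<exists>a\<in>{1..2}. \<exists>r0>0. \<exists>(r :: real ^ 'n \<Rightarrow> real) (\<omega> :: real \<Rightarrow> real).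
        (\<forall>\<rho>\<in>{0..<r0}. \<omega> \<rho> \<ge> 0) \<and> (\<omega> \<longlongrightarrow> 0) (at_right 0) \<and>
        (\<forall>x\<in>ball 0 r0. f x = Phi a x + r x \<and> \<bar>r x\<bar> \<le> \<omega> (norm x) * Phi a x))"

definition polynomial_tail :: "(real ^ 'n \<Rightarrow> real) \<Rightarrow> bool" where
  "polynomial_tail f \<longleftrightarrow>
     (\<exists>C>0. \<exists>m::real. m \<ge> 2 \<and> (\<forall>x. f x \<le> C * (1 + norm x powr m)))"

end

theory Submission
  imports Defs "HOL-Probability.Distributions"
begin

text \<open>The local profile, the quadratic lower bound and the tail bound combine into the global growth
  condition \<open>b |y|^a \<le> f y \<le> A (|y|^a + |y|^m)\<close> with \<open>1 \<le> a \<le> m\<close>. Comparing the Gaussian of variance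
  scale \<open>t\<close> with that of scale \<open>2 t\<close>, the upper bound makes \<open>P_t f 0\<close> at most a constant times
  \<open>t^(a/2)\<close>. If \<open>|x_t| > 2 sqrt t\<close>, every point of the ball of radius \<open>sqrt t\<close> about \<open>x_t\<close> has norm at
  least \<open>|x_t| / 2\<close>, and this ball carries a fixed positive amount of heat-kernel mass, so
  \<open>P_t f x_t\<close> is at least a constant times \<open>|x_t|^a\<close>. Minimality of \<open>x_t\<close> compares the two.\<close>

section \<open>The heat kernel as a normalized Gaussian\<close>

lemma heat_kernel_eq_prod_normal_density:
  fixes x y :: "real ^ 'n"
  assumes "t > 0"
  shows "heat_kernel t (x - y) = (\<Prod>b\<in>Basis. normal_density (x \<bullet> b) (sqrt (2 * t)) (y \<bullet> b))"
proof -
  have norm: "(norm (x - y))\<^sup>2 = (\<Sum>b\<in>Basis. (y \<bullet> b - x \<bullet> b)\<^sup>2)"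
    unfolding power2_norm_eq_inner euclidean_inner[of "x - y" "x - y"]
    by (intro sum.cong) (auto simp: inner_diff_left power2_eq_square algebra_simps)
  have "(\<Prod>b\<in>(Basis :: (real ^ 'n) set). 1 / sqrt (4 * pi * t)) = 1 / (sqrt (4 * pi * t)) ^ CARD('n)"
    by (simp add: power_one_over)
  also have "(sqrt (4 * pi * t)) ^ CARD('n) = (4 * pi * t) powr (real CARD('n) / 2)"
    using assms by (simp add: powr_half_sqrt[symmetric] powr_powr flip: powr_realpow)
  finally have const: "(\<Prod>b\<in>(Basis :: (real ^ 'n) set). 1 / sqrt (4 * pi * t))
      = 1 / (4 * pi * t) powr (real CARD('n) / 2)" .
  \<comment> \<open>Standard deviation \<open>sqrt (2 * t)\<close> makes twice the variance equal to
    \<open>4 * t\<close>, which matches both the exponent and the normalization of the heat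
    kernel.\<close>
  have "(\<Prod>b\<in>Basis. normal_density (x \<bullet> b) (sqrt (2 * t)) (y \<bullet> b))
      = (\<Prod>b\<in>(Basis :: (real ^ 'n) set). 1 / sqrt (4 * pi * t)) *
        (\<Prod>b\<in>Basis. exp (- (y \<bullet> b - x \<bullet> b)\<^sup>2 / (4 * t)))"
    using assms unfolding normal_density_def prod.distrib[symmetric] by (simp add: mult.assoc)
  also have "(\<Prod>b\<in>Basis. exp (- (y \<bullet> b - x \<bullet> b)\<^sup>2 / (4 * t)))
      = exp (- (norm (x - y))\<^sup>2 / (4 * t))"
    by (simp add: norm exp_sum[symmetric] sum_negf sum_divide_distrib)
  finally show ?thesis
    by (simp only: const heat_kernel_def)
qed

lemma heat_kernel_nonneg: "heat_kernel t x \<ge> 0"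
  by (simp add: heat_kernel_def)

lemma borel_measurable_heat_kernel [measurable]: "heat_kernel t \<in> borel_measurable borel"
  unfolding heat_kernel_def by measurable

text \<open>By Tonelli the integral over \<open>lborel\<close> splits into one-dimensional normal
  densities, each of mass one. The value passes to \<open>lebesgue\<close>, the completion, because
  the kernel is Borel measurable.\<close>

lemma has_bochner_integral_heat_kernel:
  fixes x :: "real ^ 'n"
  assumes "t > 0"
  shows "has_bochner_integral lebesgue (\<lambda>y. heat_kernel t (x - y)) 1"
proof -
  have gauss: "(\<integral>\<^sup>+ z. ennreal (normal_density m (sqrt (2 * t)) z) \<partial>lborel) = 1" for m
    using assms by (subst nn_integral_eq_integral) auto
  have "(\<integral>\<^sup>+ y. ennreal (heat_kernel t (x - y)) \<partial>lborel)
      = (\<integral>\<^sup>+ y. (\<Prod>b\<in>Basis. ennreal (normal_density (x \<bullet> b) (sqrt (2 * t)) (y \<bullet> b))) \<partial>lborel)"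
    using assms by (simp add: heat_kernel_eq_prod_normal_density prod_ennreal)
  also have "\<dots> = (\<Prod>b\<in>Basis. (\<integral>\<^sup>+ z. ennreal (normal_density (x \<bullet> b) (sqrt (2 * t)) z) \<partial>lborel))"
    by (rule nn_integral_lborel_prod) auto
  also have "\<dots> = 1"
    by (simp add: gauss)
  finally have "(\<integral>\<^sup>+ y. ennreal (heat_kernel t (x - y)) \<partial>lborel) = ennreal 1"
    by simp
  then have "has_bochner_integral lborel (\<lambda>y. heat_kernel t (x - y)) 1"
    by (intro has_bochner_integral_nn_integral) (auto simp: heat_kernel_nonneg)
  then show ?thesis
    by (simp add: has_bochner_integral_iff integrable_completion integral_completion)
qed

text \<open>Since -1/4 + 1/8 = -1/8, growth of this exponential order only doubles the time of the
  kernel; the factor \<open>2 powr (real CARD('n) / 2)\<close> is the change of normalization. This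
  lets growth bounds on f be integrated exactly.\<close>

lemma heat_kernel_times_exp:
  fixes z :: "real ^ 'n"
  assumes "t > 0"
  shows "heat_kernel t z * exp ((norm z)\<^sup>2 / (8 * t)) = 2 powr (real CARD('n) / 2) * heat_kernel (2 * t) z"
proof -
  have "- (norm z)\<^sup>2 / (4 * t) + (norm z)\<^sup>2 / (8 * t) = - (norm z)\<^sup>2 / (4 * (2 * t))"
    using assms by (simp add: field_simps)
  then have "exp (- (norm z)\<^sup>2 / (4 * t)) * exp ((norm z)\<^sup>2 / (8 * t)) = exp (- (norm z)\<^sup>2 / (4 * (2 * t)))"
    by (simp only: exp_add[symmetric])
  moreover have "(4 * pi * (2 * t)) powr (real CARD('n) / 2)
      = 2 powr (real CARD('n) / 2) * (4 * pi * t) powr (real CARD('n) / 2)"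
    using assms by (simp add: powr_mult[symmetric] mult.assoc mult.left_commute)
  ultimately show ?thesis
    by (simp add: heat_kernel_def mult.assoc)
qed

section \<open>Heat regularization under pointwise bounds\<close>

lemma heat_regularization_upper_bound:
  fixes f :: "real ^ 'n \<Rightarrow> real"
  assumes meas: "f \<in> borel_measurable lebesgue" and "t > 0"
    and nonneg: "\<And>y. f y \<ge> 0"
    and bound: "\<And>y. f y \<le> K * exp ((norm (x - y))\<^sup>2 / (8 * t))"
  shows "integrable lebesgue (\<lambda>y. heat_kernel t (x - y) * f y)"
    and "heat_regularization t f x \<le> K * 2 powr (real CARD('n) / 2)"
proof -
  \<comment> \<open>The majorant is a multiple of the kernel at time \<open>2 * t\<close>, which
    again has mass one.\<close>
  let ?g = "\<lambda>y. K * 2 powr (real CARD('n) / 2) * heat_kernel (2 * t) (x - y)"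
  have hb: "has_bochner_integral lebesgue (\<lambda>y. heat_kernel (2 * t) (x - y)) 1"
    using \<open>t > 0\<close> by (intro has_bochner_integral_heat_kernel) simp
  have g: "integrable lebesgue ?g"
    using hb by (intro integrable_mult_right) (auto simp: has_bochner_integral_iff)
  have le: "heat_kernel t (x - y) * f y \<le> ?g y" for y
    using mult_left_mono[OF bound[of y] heat_kernel_nonneg[of t "x - y"]]
      heat_kernel_times_exp[OF \<open>t > 0\<close>, of "x - y"]
    by (simp add: mult.assoc mult.left_commute)
  have [measurable]: "(\<lambda>y. heat_kernel t (x - y)) \<in> borel_measurable lebesgue"
    by (rule measurable_completion) measurable
  show int: "integrable lebesgue (\<lambda>y. heat_kernel t (x - y) * f y)"
  proof (rule Bochner_Integration.integrable_bound[OF g])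
    show "(\<lambda>y. heat_kernel t (x - y) * f y) \<in> borel_measurable lebesgue"
      using meas by measurable
    show "AE y in lebesgue. norm (heat_kernel t (x - y) * f y) \<le> norm (?g y)"
      using order_trans[OF le abs_ge_self] by (intro AE_I2) (simp add: nonneg heat_kernel_nonneg)
  qed
  have "heat_regularization t f x \<le> (LINT y|lebesgue. ?g y)"
    unfolding heat_regularization_def by (rule integral_mono[OF int g le])
  also have "\<dots> = K * 2 powr (real CARD('n) / 2)"
    using hb by (simp add: has_bochner_integral_iff)
  finally show "heat_regularization t f x \<le> K * 2 powr (real CARD('n) / 2)" .
qed

text \<open>On the ball of radius \<open>sqrt t\<close> the exponent of the kernel is at least -1/4,
  and the volume of the ball, of order t^(n/2), cancels the normalization, so the constant depends
  on neither t nor x. Integrability is assumed because the integral of a non-integrable function is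
  0 by convention.\<close>

lemma heat_regularization_lower_bound:
  fixes f :: "real ^ 'n \<Rightarrow> real"
  assumes int: "integrable lebesgue (\<lambda>y. heat_kernel t (x - y) * f y)" and "t > 0"
    and nonneg: "\<And>y. f y \<ge> 0" and "L \<ge> 0"
    and bound: "\<And>y. y \<in> ball x (sqrt t) \<Longrightarrow> f y \<ge> L"
  shows "heat_regularization t f x
    \<ge> unit_ball_vol (real CARD('n)) * exp (- 1 / 4) / (4 * pi) powr (real CARD('n) / 2) * L"
proof -
  define h where "h = 1 / (4 * pi * t) powr (real CARD('n) / 2) * exp (- 1 / 4)"
  let ?g = "\<lambda>y. indicator (ball x (sqrt t)) y * (h * L)"
  have le: "?g y \<le> heat_kernel t (x - y) * f y" for y
  proof (cases "y \<in> ball x (sqrt t)")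
    case True
    then have "(norm (x - y))\<^sup>2 \<le> (sqrt t)\<^sup>2"
      by (intro power_mono) (auto simp: dist_norm)
    then have "heat_kernel t (x - y) \<ge> h"
      using \<open>t > 0\<close> unfolding heat_kernel_def h_def
      by (intro mult_left_mono) (auto simp: field_simps)
    then show ?thesis
      using True bound[OF True] \<open>L \<ge> 0\<close> heat_kernel_nonneg[of t "x - y"] by (auto intro: mult_mono)
  next
    case False
    then show ?thesis by (simp add: nonneg heat_kernel_nonneg)
  qed
  have vol: "measure lebesgue (ball x (sqrt t)) = unit_ball_vol (real CARD('n)) * sqrt t ^ CARD('n)"
    using \<open>t > 0\<close> by (simp add: content_ball)
  have "sqrt t ^ CARD('n) = t powr (real CARD('n) / 2)"
    using \<open>t > 0\<close> by (simp add: powr_half_sqrt[symmetric] powr_powr flip: powr_realpow)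
  moreover have "(4 * pi * t) powr (real CARD('n) / 2)
      = (4 * pi) powr (real CARD('n) / 2) * t powr (real CARD('n) / 2)"
    using \<open>t > 0\<close> by (simp add: powr_mult)
  ultimately have "measure lebesgue (ball x (sqrt t)) * (h * L)
      = unit_ball_vol (real CARD('n)) * exp (- 1 / 4) / (4 * pi) powr (real CARD('n) / 2) * L"
    using \<open>t > 0\<close> by (simp add: vol h_def)
  moreover have "(LINT y|lebesgue. ?g y) = measure lebesgue (ball x (sqrt t)) * (h * L)"
    by simp
  moreover have "(LINT y|lebesgue. ?g y) \<le> heat_regularization t f x"
    unfolding heat_regularization_def
    by (rule integral_mono[OF _ int le])
       (auto intro!: integrable_mult_left integrable_real_indicator simp: emeasure_lborel_ball_finite[unfolded infinity_ennreal_def])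
  ultimately show ?thesis by simp
qed

section \<open>Growth of powers, of \<open>Phi\<close> and of f\<close>

lemma powr_le_exp_square:
  fixes p :: real
  assumes "p \<ge> 0"
  obtains K where "K > 0" "\<And>u. u \<ge> 0 \<Longrightarrow> u powr p \<le> K * exp (u\<^sup>2 / 16)"
proof
  define k where "k = Suc (nat \<lceil>p\<rceil>)"
  show "1 + (16 * real k) ^ k > 0"
    by (simp add: add_pos_pos k_def)
  fix u :: real assume "u \<ge> 0"
  have k: "p \<le> real k" "k > 0" by (simp_all add: k_def) linarith
  \<comment> \<open>With v = u^2 / (16 k), the inequality v \<le> exp v raised to the power k bounds
    (u^2)^k by a multiple of exp (u^2 / 16). An integer k \<ge> p suffices, the range u \<le> 1
    being covered by the constant 1.\<close>
  have "(u\<^sup>2 / 16 / real k) ^ k \<le> exp (u\<^sup>2 / 16 / real k) ^ k"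
    using exp_ge_add_one_self[of "u\<^sup>2 / 16 / real k"] by (intro power_mono) (linarith, simp)
  also have "\<dots> = exp (u\<^sup>2 / 16)"
    using k by (simp flip: exp_of_nat_mult)
  finally have exp: "(u\<^sup>2) ^ k \<le> (16 * real k) ^ k * exp (u\<^sup>2 / 16)"
    using k by (simp add: power_divide power_mult_distrib field_simps)
  have "u powr p \<le> 1 + (u\<^sup>2) ^ k"
  proof (cases "u \<le> 1")
    case True
    then have "u powr p \<le> 1" using \<open>u \<ge> 0\<close> assms by (simp add: powr_le1)
    then show ?thesis by (simp add: add_increasing2)
  next
    case False
    then have "u powr p \<le> u powr (real (2 * k))" using k by (intro powr_mono) auto
    also have "\<dots> = (u\<^sup>2) ^ k" using False by (simp add: powr_realpow power_mult del: of_nat_mult)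
    finally show ?thesis by simp
  qed
  also have "\<dots> \<le> exp (u\<^sup>2 / 16) + (16 * real k) ^ k * exp (u\<^sup>2 / 16)"
    using exp by (intro add_mono) auto
  finally show "u powr p \<le> (1 + (16 * real k) ^ k) * exp (u\<^sup>2 / 16)"
    by (simp add: algebra_simps)
qed

lemma Phi_upper_bound:
  fixes x :: "real ^ 'n"
  assumes "a \<ge> 0"
  shows "Phi a x \<le> real CARD('n) * norm x powr a"
proof -
  have "Phi a x \<le> (\<Sum>i\<in>(UNIV :: 'n set). norm x powr a)"
    unfolding Phi_def using assms by (intro sum_mono powr_mono2) (auto intro: component_le_norm_cart)
  then show ?thesis by simp
qed

text \<open>The Euclidean norm is at most the sum of the absolute coordinates, so some coordinate is
  at least \<open>norm x / real CARD('n)\<close>; its term alone gives the bound.\<close>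

lemma Phi_lower_bound:
  fixes x :: "real ^ 'n"
  assumes "a \<ge> 0"
  shows "(norm x / real CARD('n)) powr a \<le> Phi a x"
proof -
  obtain i where i: "norm x / real CARD('n) \<le> \<bar>x $ i\<bar>"
  proof (rule ccontr)
    assume "\<not> thesis"
    with that have "\<bar>x $ i\<bar> < norm x / real CARD('n)" for i by (meson not_le)
    then have "(\<Sum>i\<in>UNIV. \<bar>x $ i\<bar>) < (\<Sum>i\<in>(UNIV :: 'n set). norm x / real CARD('n))"
      by (intro sum_strict_mono) auto
    with norm_le_l1_cart[of x] show False by simp
  qed
  have "(norm x / real CARD('n)) powr a \<le> \<bar>x $ i\<bar> powr a"
    using assms i by (intro powr_mono2) auto
  also have "\<dots> \<le> Phi a x"
    unfolding Phi_def by (intro member_le_sum) auto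
  finally show ?thesis .
qed

text \<open>Near the origin f is comparable to \<open>Phi a\<close>, hence to |y|^a; at distance at
  least \<open>\<delta>\<close> the quadratic and tail bounds take over. The same exponent a in both
  bounds lets the powers of t cancel in the final comparison.\<close>

lemma two_sided_growth:
  fixes f :: "real ^ 'n \<Rightarrow> real"
  assumes "quadratic_lower_bound f" "local_profile f" "polynomial_tail f"
  obtains a b A m :: real where "1 \<le> a" "a \<le> m" "b > 0" "A > 0"
    "\<And>y. b * norm y powr a \<le> f y" "\<And>y. f y \<le> A * (norm y powr a + norm y powr m)"
proof -
  let ?N = "real CARD('n)"
  obtain c where c: "c > 0" "\<And>y. f y \<ge> c * (norm y)\<^sup>2" and f0: "f 0 = 0"
    using assms(1) unfolding quadratic_lower_bound_def by blast
  obtain a r0 r \<omega> where a: "1 \<le> a" "a \<le> 2" and r0: "r0 > 0"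
    and \<omega>: "(\<omega> \<longlongrightarrow> 0) (at_right 0)"
    and profile: "\<And>y. y \<in> ball 0 r0 \<Longrightarrow> f y = Phi a y + r y \<and> \<bar>r y\<bar> \<le> \<omega> (norm y) * Phi a y"
    using assms(2) unfolding local_profile_def by (metis atLeastAtMost_iff)
  obtain C m where C: "C > 0" "m \<ge> 2" "\<And>y. f y \<le> C * (1 + norm y powr m)"
    using assms(3) unfolding polynomial_tail_def by blast
  have "eventually (\<lambda>\<rho>. \<omega> \<rho> < 1 / 2) (at_right 0)"
    using \<omega> by (rule order_tendstoD) simp
  then obtain \<delta>0 where \<delta>0: "\<delta>0 > 0" "\<And>\<rho>. 0 < \<rho> \<Longrightarrow> \<rho> < \<delta>0 \<Longrightarrow> \<omega> \<rho> < 1 / 2"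
    unfolding eventually_at_right_field by blast
  define \<delta> where "\<delta> = min \<delta>0 r0"
  have \<delta>: "\<delta> > 0" using \<delta>0 r0 by (simp add: \<delta>_def)
  \<comment> \<open>The limit from the right does not control \<open>\<omega> 0\<close>, so the
    origin is excluded here and handled by \<open>f 0 = 0\<close>.\<close>
  have near: "Phi a y / 2 \<le> f y \<and> f y \<le> 2 * Phi a y" if "y \<noteq> 0" "norm y < \<delta>" for y
  proof -
    have "Phi a y \<ge> 0" by (simp add: Phi_def sum_nonneg)
    moreover have "\<omega> (norm y) < 1 / 2" using that \<delta>0 by (simp add: \<delta>_def)
    ultimately have "\<omega> (norm y) * Phi a y \<le> 1 / 2 * Phi a y"
      by (intro mult_right_mono) auto
    moreover have "f y = Phi a y + r y" "\<bar>r y\<bar> \<le> \<omega> (norm y) * Phi a y"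
      using profile[of y] that by (auto simp: \<delta>_def)
    ultimately show ?thesis using \<open>Phi a y \<ge> 0\<close> by linarith
  qed
  \<comment> \<open>In each constant the first entry serves the punctured ball of radius
    \<open>\<delta>\<close> and the second its exterior. There |y|^2 \<ge>
    \<open>\<delta> powr (2 - a)\<close> |y|^a because a \<le> 2, and 1 \<le> |y|^m /
    \<open>\<delta> powr m\<close> absorbs the additive constant of the tail bound.\<close>
  define b where "b = min ((1 / ?N) powr a / 2) (c * \<delta> powr (2 - a))"
  define A where "A = max (2 * ?N) (C * (1 / \<delta> powr m + 1))"
  have "b > 0" using c \<delta> by (simp add: b_def)
  have "A > 0" by (simp add: A_def less_max_iff_disj)
  have lower: "b * norm y powr a \<le> f y" for y
  proof -
    consider "y = 0" | "y \<noteq> 0" "norm y < \<delta>" | "norm y \<ge> \<delta>" by fastforce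
    then show ?thesis
    proof cases
      case 1
      then show ?thesis by (simp add: f0)
    next
      case 2
      have "b * norm y powr a \<le> (1 / ?N) powr a / 2 * norm y powr a"
        by (intro mult_right_mono) (auto simp: b_def)
      also have "\<dots> = (norm y / ?N) powr a / 2"
        by (simp add: powr_divide)
      also have "\<dots> \<le> f y"
        using Phi_lower_bound[of a y] a near[OF 2] by simp
      finally show ?thesis .
    next
      case 3
      then have "norm y > 0" using \<delta> by linarith
      have "b * norm y powr a \<le> c * \<delta> powr (2 - a) * norm y powr a"
        by (intro mult_right_mono) (auto simp: b_def)
      also have "\<dots> \<le> c * norm y powr (2 - a) * norm y powr a"
        using 3 \<delta> a c by (intro mult_right_mono mult_left_mono powr_mono2) auto
      also have "\<dots> = c * (norm y)\<^sup>2"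
        using \<open>norm y > 0\<close> by (simp add: mult.assoc powr_add[symmetric])
      finally show ?thesis using c(2)[of y] by linarith
    qed
  qed
  have upper: "f y \<le> A * (norm y powr a + norm y powr m)" for y
  proof -
    consider "y = 0" | "y \<noteq> 0" "norm y < \<delta>" | "norm y \<ge> \<delta>" by fastforce
    then show ?thesis
    proof cases
      case 1
      then show ?thesis by (simp add: f0)
    next
      case 2
      have "f y \<le> 2 * ?N * norm y powr a"
        using near[OF 2] Phi_upper_bound[of a y] a by linarith
      also have "\<dots> \<le> A * (norm y powr a + norm y powr m)"
        using \<open>A > 0\<close> by (intro mult_mono) (auto simp: A_def)
      finally show ?thesis .
    next
      case 3
      then have "\<delta> powr m \<le> norm y powr m"
        using \<delta> C by (intro powr_mono2) auto
      then have "1 \<le> 1 / \<delta> powr m * norm y powr m"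
        using \<delta> by (simp add: field_simps)
      then have "C * (1 + norm y powr m) \<le> C * ((1 / \<delta> powr m + 1) * norm y powr m)"
        using C by (intro mult_left_mono) (auto simp: algebra_simps)
      also have "\<dots> \<le> A * (norm y powr a + norm y powr m)"
        unfolding mult.assoc[symmetric] using \<open>A > 0\<close> by (intro mult_mono) (auto simp: A_def)
      finally show ?thesis using C(3)[of y] by linarith
    qed
  qed
  show thesis
    using a C \<open>b > 0\<close> \<open>A > 0\<close> lower upper by (intro that[of a m b A]) auto
qed

section \<open>Comparison of the values at the origin and at the minimizer\<close>

theorem theorem4p4:
  fixes f :: "real ^ 'n \<Rightarrow> real" and x :: "real \<Rightarrow> real ^ 'n"
  assumes "f \<in> borel_measurable lebesgue"
    and "quadratic_lower_bound f"
    and "local_profile f"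
    and "polynomial_tail f"
    and "\<And>t. t > 0 \<Longrightarrow> is_arg_min (heat_regularization t f) (\<lambda>_. True) (x t)"
  shows "\<exists>M>0. \<exists>t0>0. \<forall>t. 0 < t \<and> t < t0 \<longrightarrow> norm (x t) \<le> M * sqrt t"
proof -
  obtain a b A m where a: "1 \<le> a" "a \<le> m" and b: "b > 0" and A: "A > 0"
    and lower: "\<And>y. b * norm y powr a \<le> f y"
    and upper: "\<And>y. f y \<le> A * (norm y powr a + norm y powr m)"
    by (rule two_sided_growth[OF assms(2-4)]) (rule that)
  have nonneg: "f y \<ge> 0" for y
    by (rule order_trans[OF _ lower]) (use b in simp)
  obtain Ka where Ka: "Ka > 0" "\<And>u. u \<ge> 0 \<Longrightarrow> u powr a \<le> Ka * exp (u\<^sup>2 / 16)"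
    using powr_le_exp_square[of a] a by auto
  obtain Km where Km: "Km > 0" "\<And>u. u \<ge> 0 \<Longrightarrow> u powr m \<le> Km * exp (u\<^sup>2 / 16)"
    using powr_le_exp_square[of m] a by auto
  \<comment> \<open>The rate 1 / (16 t) is half of what the upper bound lemma admits, which leaves
    room to move the centre from 0 to \<open>x t\<close>.\<close>
  have growth: "f y \<le> A * (Ka + Km) * sqrt t powr a * exp ((norm y)\<^sup>2 / (16 * t))"
    if t: "0 < t" "t < 1" for t y
  proof -
    \<comment> \<open>Substitute u = |y| / sqrt t. As t < 1 and p \<ge> a,
      \<open>sqrt t powr p\<close> is at most \<open>sqrt t powr a\<close>, so the tail term scales
      no worse than the leading one.\<close>
    have scaled: "norm y powr p \<le> K * sqrt t powr a * exp ((norm y)\<^sup>2 / (16 * t))"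
      if K: "K > 0" "\<And>u. u \<ge> 0 \<Longrightarrow> u powr p \<le> K * exp (u\<^sup>2 / 16)" and "a \<le> p" for p K
    proof -
      have "norm y powr p = sqrt t powr p * (norm y / sqrt t) powr p"
        using t by (simp add: powr_divide)
      also have "\<dots> \<le> sqrt t powr a * (K * exp ((norm y / sqrt t)\<^sup>2 / 16))"
        using t K \<open>a \<le> p\<close> by (intro mult_mono powr_mono') auto
      also have "(norm y / sqrt t)\<^sup>2 / 16 = (norm y)\<^sup>2 / (16 * t)"
        using t by (simp add: power_divide)
      finally show ?thesis by (simp add: mult_ac)
    qed
    have "norm y powr a + norm y powr m \<le> (Ka + Km) * sqrt t powr a * exp ((norm y)\<^sup>2 / (16 * t))"
      using scaled[OF Ka order_refl] scaled[OF Km a(2)] by (simp add: algebra_simps)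
    from order_trans[OF upper mult_left_mono[OF this less_imp_le[OF A]]] show ?thesis
      by (simp add: mult.assoc)
  qed

  \<comment> \<open>\<open>\<kappa>\<close> is the constant of the lower bound lemma;
    \<open>R\<close> is the quotient of the constants left once \<open>sqrt t powr a\<close>
    cancels.\<close>
  define \<kappa> where "\<kappa> = unit_ball_vol (real CARD('n)) * exp (- 1 / 4) / (4 * pi) powr (real CARD('n) / 2)"
  define R where "R = A * (Ka + Km) * 2 powr (real CARD('n) / 2) / (\<kappa> * b)"
  have "\<kappa> > 0" by (simp add: \<kappa>_def)
  have "R > 0" using A Ka Km b \<open>\<kappa> > 0\<close> by (simp add: R_def)
  \<comment> \<open>The summand 2 covers minimizers within \<open>2 * sqrt t\<close>; for the others
    \<open>norm (x t) = 2 * u * sqrt t\<close>, and u \<le> R will follow.\<close>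
  have "norm (x t) \<le> (2 + 2 * R) * sqrt t" if t: "0 < t" "t < 1" for t
  proof (cases "norm (x t) \<le> 2 * sqrt t")
    case True
    then show ?thesis using t \<open>R > 0\<close> by (simp add: distrib_right add_increasing2)
  next
    case False
    define u where "u = norm (x t) / (2 * sqrt t)"
    have u: "norm (x t) / 2 = u * sqrt t" "u \<ge> 1"
      using False t by (auto simp: u_def field_simps)
    let ?K = "A * (Ka + Km) * sqrt t powr a"
    have K: "?K \<ge> 0" using A Ka Km by simp
    have "f y \<le> ?K * exp ((norm (0 - y))\<^sup>2 / (8 * t))" for y
    proof -
      have "exp ((norm y)\<^sup>2 / (16 * t)) \<le> exp ((norm y)\<^sup>2 / (8 * t))"
        using t by (simp add: frac_le)
      from mult_left_mono[OF this K] growth[OF t, of y] show ?thesis by simp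
    qed
    from heat_regularization_upper_bound(2)[OF assms(1) t(1) nonneg this]
    have at_0: "heat_regularization t f 0 \<le> ?K * 2 powr (real CARD('n) / 2)" .

    \<comment> \<open>Recentring by |y|^2 \<le> 2 |x_t|^2 + 2 |x_t - y|^2 costs a factor that may be
      huge for small t. This is harmless, since the bound only yields integrability.\<close>
    have "f y \<le> ?K * exp ((norm (x t))\<^sup>2 / (8 * t)) * exp ((norm (x t - y))\<^sup>2 / (8 * t))" for y
    proof -
      have "norm y \<le> norm (x t) + norm (x t - y)"
        using norm_triangle_ineq4[of "x t" "x t - y"] by simp
      then have "(norm y)\<^sup>2 \<le> (norm (x t) + norm (x t - y))\<^sup>2"
        by (intro power_mono) auto
      also have "\<dots> \<le> 2 * (norm (x t))\<^sup>2 + 2 * (norm (x t - y))\<^sup>2"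
        using sum_squares_bound[of "norm (x t)" "norm (x t - y)"] by (simp add: power2_sum)
      finally have "(norm y)\<^sup>2 / (16 * t) \<le> (norm (x t))\<^sup>2 / (8 * t) + (norm (x t - y))\<^sup>2 / (8 * t)"
        using t by (simp add: field_simps)
      then have "exp ((norm y)\<^sup>2 / (16 * t)) \<le> exp ((norm (x t))\<^sup>2 / (8 * t)) * exp ((norm (x t - y))\<^sup>2 / (8 * t))"
        by (simp add: exp_add[symmetric])
      from mult_left_mono[OF this K] growth[OF t, of y] show ?thesis by (simp add: mult.assoc)
    qed
    then have int: "integrable lebesgue (\<lambda>y. heat_kernel t (x t - y) * f y)"
      by (rule heat_regularization_upper_bound(1)[OF assms(1) t(1) nonneg])

    have ball: "b * (norm (x t) / 2) powr a \<le> f y" if "y \<in> ball (x t) (sqrt t)" for y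
    proof -
      have "norm (x t) \<le> norm y + norm (x t - y)"
        using norm_triangle_ineq[of y "x t - y"] by simp
      then have "norm (x t) / 2 \<le> norm y"
        using that False by (simp add: dist_norm)
      then have "b * (norm (x t) / 2) powr a \<le> b * norm y powr a"
        using a b by (intro mult_left_mono powr_mono2) auto
      then show ?thesis using lower[of y] by linarith
    qed
    have "\<kappa> * (b * (norm (x t) / 2) powr a) \<le> heat_regularization t f (x t)"
      unfolding \<kappa>_def by (rule heat_regularization_lower_bound[OF int t(1) nonneg _ ball]) (use b in auto)
    also have "\<dots> \<le> heat_regularization t f 0"
      using assms(5)[OF t(1)] by (simp add: is_arg_min_linorder)
    also note at_0
    finally have "(\<kappa> * b * u powr a) * sqrt t powr a
        \<le> (A * (Ka + Km) * 2 powr (real CARD('n) / 2)) * sqrt t powr a"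
      using u t by (simp add: powr_mult mult_ac)
    then have "\<kappa> * b * u powr a \<le> A * (Ka + Km) * 2 powr (real CARD('n) / 2)"
      by (rule mult_right_le_imp_le) (use t in simp)
    then have "u powr a \<le> R"
      using b \<open>\<kappa> > 0\<close> by (simp add: R_def field_simps)
    \<comment> \<open>Here a \<ge> 1 and u \<ge> 1 enter: the bound on \<open>u powr a\<close>
      bounds u itself.\<close>
    moreover have "u \<le> u powr a"
      using powr_mono[of 1 a u] a u by simp
    ultimately have "2 * u * sqrt t \<le> (2 + 2 * R) * sqrt t"
      using t by (intro mult_right_mono) auto
    then show ?thesis using u(1) by simp
  qed
  then show ?thesis
    using \<open>R > 0\<close> by (intro exI[of _ "2 + 2 * R"] conjI exI[of _ 1]) auto
qed

end
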